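(* Let $\mathbb{K}=\mathbb{C}$ or $\mathbb{R}$, let $p\ge0$, and for $\lambda\in\mathbb{K}$ let $f_\lambda:(\mathbb{K}^{2}\times\mathbb{K}^p,0)\to(\mathbb{K},0)$ be the germ $$f_\lambda(u,v,w)=u^3-3\lambda^2uv^4+v^6+w^2,\qquad w=(w_1,\dots,w_p),\quad w^2:=w_1^2+\cdots+w_p^2 .$$ Let $\lambda,\lambda'\in\mathbb{K}$ with $1\pm2\lambda^3\neq0$ and $1\pm2\lambda'^3\ne0$ (for both choices of sign). If $f_\lambda$ and $f_{\lambda'}$ are bi-Lipschitz equivalent, then $\lambda^3=\pm\lambda'^3$.
   Context: Two function germs $f,g:(\mathbb{K}^N,0)\to(\mathbb{K},0)$ are bi-Lipschitz equivalent if there is a germ of homeomorphism $\varphi:(\mathbb{K}^N,0)\to(\mathbb{K}^N,0)$ with $f\circ\varphi=g$ and a constant $L>0$ such that $\frac1L\|x-y\|\le\|\varphi(x)-\varphi(y)\|\le L\|x-y\|$ for all $x,y$ near $0$. *)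

theory Defs
  imports "HOL-Analysis.Analysis"
begin

definition germ_homeomorphism :: "('a::real_normed_vector \<Rightarrow> 'a) \<Rightarrow> bool" where
  "germ_homeomorphism \<phi> \<longleftrightarrow> \<phi> 0 = 0 \<and>
     (\<exists>U V \<psi>. open U \<and> 0 \<in> U \<and> open V \<and> 0 \<in> V \<and> homeomorphism U V \<phi> \<psi>)"

(* Germs at 0 are represented by total functions; only their values near 0 matter. *)
definition bilipschitz_equivalent :: "('a::real_normed_vector \<Rightarrow> 'b) \<Rightarrow> ('a \<Rightarrow> 'b) \<Rightarrow> bool" where
  "bilipschitz_equivalent f g \<longleftrightarrow>
     (\<exists>\<phi>. germ_homeomorphism \<phi> \<and>
          (\<forall>\<^sub>F x in nhds 0. f (\<phi> x) = g x) \<and>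
          (\<exists>L>0. \<exists>r>0. \<forall>x\<in>ball 0 r. \<forall>y\<in>ball 0 r.
             1 / L * norm (x - y) \<le> norm (\<phi> x - \<phi> y) \<and>
             norm (\<phi> x - \<phi> y) \<le> L * norm (x - y)))"

(* The germ u^3 - 3 l^2 u v^4 + v^6 + w_1^2 + ... + w_p^2 on K^(2+p).  Index types are
   nonempty, so a factor K^p given by its own index type would exclude p = 0.  Instead
   all p + 2 coordinates are indexed by 'n: for distinct i and j, u and v are the
   coordinates i and j, and the w_k are the remaining CARD('n) - 2 coordinates. *)
definition germ_family :: "'n::finite \<Rightarrow> 'n \<Rightarrow> 'k::comm_ring_1 \<Rightarrow> 'k ^ 'n \<Rightarrow> 'k" where
  "germ_family i j l x =
     (let u = x $ i; v = x $ j
      in u ^ 3 - 3 * l ^ 2 * u * v ^ 4 + v ^ 6 + (\<Sum>k\<in>UNIV - {i, j}. (x $ k) ^ 2))"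

end

theory Submission
  imports Defs
begin

text \<open>If \<open>f \<circ> \<phi> = g\<close> with \<open>\<phi>\<close> bi-Lipschitz of constant \<open>L\<close>, then
  the differentials satisfy \<open>\<bar>df(\<phi> x)\<bar> \<le> L \<bar>dg(x)\<bar>\<close>.  At the points
  \<open>x = (\<plusminus>\<lambda>' \<epsilon>\<^sup>2, \<epsilon>, 0)\<close> the \<open>u\<close>- and \<open>w\<close>-derivatives of \<open>g = f\<^bsub>\<lambda>'\<^esub>\<close>
  vanish and the \<open>v\<close>-derivative is of order \<open>\<epsilon>\<^sup>5\<close>.  Hence, writing \<open>\<phi> x = (t \<epsilon>\<^sup>2, s \<epsilon>, w)\<close>,
  one gets \<open>t\<^sup>2 = \<lambda>\<^sup>2 s\<^sup>4 + O(\<epsilon>)\<close> and \<open>w = O(\<epsilon>\<^sup>5)\<close>, while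
  \<open>t\<^sup>3 - 3 \<lambda>\<^sup>2 t s\<^sup>4 + s\<^sup>6 = 1 \<minusplus> 2 \<lambda>'\<^sup>3 + o(1)\<close>.  The two points are only
  \<open>O(\<epsilon>\<^sup>2)\<close> apart, so along a subsequence both have the same limit of \<open>s\<close>; for
  \<open>\<lambda>' \<noteq> 0\<close> the limit equations force \<open>s\<^sup>6 = 1\<close> and \<open>\<lambda>'\<^sup>3 = \<plusminus>\<lambda>\<^sup>3\<close>.
  If \<open>\<lambda>' = 0\<close>, exchange the two germs.\<close>

section \<open>Bi-Lipschitz equivalence as a pair of Lipschitz maps on one ball\<close>

text \<open>The two germs enter symmetrically here, so that they can be exchanged later. The lower
  bi-Lipschitz bound on \<open>\<phi>\<close> becomes the upper bound on its local inverse
  \<open>\<psi>\<close>.\<close>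

lemma bilipschitz_equivalentE:
  fixes f g :: "'a::real_normed_vector \<Rightarrow> 'b"
  assumes "bilipschitz_equivalent f g"
  obtains \<phi> \<psi> L r where "L > 0" "r > 0" "\<phi> 0 = 0" "\<psi> 0 = 0"
    "\<And>x. x \<in> ball 0 r \<Longrightarrow> \<psi> (\<phi> x) = x" "\<And>y. y \<in> ball 0 r \<Longrightarrow> \<phi> (\<psi> y) = y"
    "\<And>x. x \<in> ball 0 r \<Longrightarrow> f (\<phi> x) = g x" "\<And>y. y \<in> ball 0 r \<Longrightarrow> g (\<psi> y) = f y"
    "L-lipschitz_on (ball 0 r) \<phi>" "L-lipschitz_on (ball 0 r) \<psi>"
proof -
  from assms obtain \<phi> L r1 where hom: "germ_homeomorphism \<phi>"
    and ev: "\<forall>\<^sub>F x in nhds 0. f (\<phi> x) = g x" and L: "L > 0" "r1 > 0"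
    and bil: "\<And>x y. x \<in> ball 0 r1 \<Longrightarrow> y \<in> ball 0 r1 \<Longrightarrow>
      1 / L * norm (x - y) \<le> norm (\<phi> x - \<phi> y) \<and> norm (\<phi> x - \<phi> y) \<le> L * norm (x - y)"
    unfolding bilipschitz_equivalent_def by blast
  from hom obtain U V \<psi> where \<phi>0: "\<phi> 0 = 0" and UV: "open U" "0 \<in> U" "open V" "0 \<in> V"
    and h: "homeomorphism U V \<phi> \<psi>"
    unfolding germ_homeomorphism_def by blast
  from ev obtain S where S: "open S" "0 \<in> S" "\<And>x. x \<in> S \<Longrightarrow> f (\<phi> x) = g x"
    unfolding eventually_nhds by blast
  have "open (S \<inter> U \<inter> ball 0 r1)" "0 \<in> S \<inter> U \<inter> ball 0 r1"
    using S UV L by auto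
  then obtain \<rho> where \<rho>: "\<rho> > 0" "ball 0 \<rho> \<subseteq> S \<inter> U \<inter> ball 0 r1"
    using open_contains_ball by metis
  have \<psi>0: "\<psi> 0 = 0"
    using h UV(2) \<phi>0 homeomorphism_apply1 by fastforce
  have "continuous_on V \<psi>"
    using h homeomorphism_cont2 by blast
  then have "open (\<psi> -` ball 0 \<rho> \<inter> V)"
    using UV(3) by (simp add: continuous_on_open_vimage)
  moreover have "0 \<in> \<psi> -` ball 0 \<rho> \<inter> V"
    using \<psi>0 \<rho> UV by simp
  ultimately obtain r2 where r2: "r2 > 0" "ball 0 r2 \<subseteq> \<psi> -` ball 0 \<rho> \<inter> V"
    using open_contains_ball by metis
  \<comment> \<open>All the data on \<open>\<phi>\<close> are valid on \<open>ball 0 \<rho>\<close>.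
    The radius \<open>r2\<close> makes \<open>\<psi>\<close> land in that ball, so the minimum
    serves both maps.\<close>
  define r where "r = min \<rho> r2"
  have sub: "x \<in> S" "x \<in> U" "x \<in> ball 0 r1" if "x \<in> ball 0 \<rho>" for x
    using that \<rho> by auto
  have sub': "\<psi> y \<in> ball 0 \<rho>" "y \<in> V" if "y \<in> ball 0 r" for y
    using that r2 by (auto simp: r_def)
  have sub'': "x \<in> ball 0 \<rho>" if "x \<in> ball 0 r" for x
    using that by (simp add: r_def)
  have inv: "\<phi> (\<psi> y) = y" if "y \<in> ball 0 r" for y
    using sub'[OF that] h homeomorphism_apply2 by fastforce
  show thesis
  proof
    show "L > 0" "r > 0" "\<phi> 0 = 0" "\<psi> 0 = 0"
      using L \<rho> r2 \<phi>0 \<psi>0 by (auto simp: r_def)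
    show "\<psi> (\<phi> x) = x" if "x \<in> ball 0 r" for x
      using sub(2)[OF sub''[OF that]] h homeomorphism_apply1 by fastforce
    show "\<phi> (\<psi> y) = y" if "y \<in> ball 0 r" for y
      by (fact inv[OF that])
    show "f (\<phi> x) = g x" if "x \<in> ball 0 r" for x
      using S(3) sub(1)[OF sub''[OF that]] by blast
    show "g (\<psi> y) = f y" if "y \<in> ball 0 r" for y
      using S(3)[OF sub(1)[OF sub'(1)[OF that]]] inv[OF that] by simp
    show "L-lipschitz_on (ball 0 r) \<phi>"
      using bil[OF sub(3)[OF sub''] sub(3)[OF sub'']] L
      by (intro lipschitz_onI) (simp_all add: dist_norm)
    show "L-lipschitz_on (ball 0 r) \<psi>"
    proof (rule lipschitz_onI)
      fix x y :: 'a assume xy: "x \<in> ball 0 r" "y \<in> ball 0 r"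
      have "1 / L * norm (\<psi> x - \<psi> y) \<le> norm (x - y)"
        using bil[OF sub(3)[OF sub'(1)[OF xy(1)]] sub(3)[OF sub'(1)[OF xy(2)]]] inv xy by simp
      then show "dist (\<psi> x) (\<psi> y) \<le> L * dist x y"
        using L by (simp add: dist_norm field_simps)
    qed (use L in simp)
  qed
qed

section \<open>Differentials under a Lipschitz change of variables\<close>

text \<open>No chain rule applies, since \<open>\<psi>\<close> need not be differentiable. Instead
  the increment of \<open>f\<close> from \<open>q\<close> to \<open>q + t h\<close> is an increment
  of \<open>g\<close> over a distance at most \<open>L * t * norm h\<close>, hence at most
  \<open>M + o(1)\<close> times that distance; divide by \<open>t\<close>.\<close>

lemma has_derivative_norm_le_of_lipschitz_factor:
  fixes f :: "'a::real_normed_vector \<Rightarrow> 'c::real_normed_vector"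
    and g :: "'b::real_normed_vector \<Rightarrow> 'c"
  assumes f: "(f has_derivative F) (at q)" and g: "(g has_derivative G) (at (\<psi> q))"
    and S: "open S" "q \<in> S" and eq: "\<And>y. y \<in> S \<Longrightarrow> g (\<psi> y) = f y"
    and lip: "L-lipschitz_on S \<psi>" and M: "\<And>h. norm (G h) \<le> M * norm h" "M \<ge> 0"
  shows "norm (F h) \<le> L * M * norm h"
proof (rule field_le_epsilon)
  have L: "L \<ge> 0"
    using lip lipschitz_on_nonneg by blast
  fix e :: real assume e: "e > 0"
  \<comment> \<open>The total error is \<open>\<eta> * (L + 1) * norm h\<close>: the part with
    \<open>L\<close> comes from expanding \<open>g\<close>, the other from expanding
    \<open>f\<close>. The last \<open>+ 1\<close> keeps the denominator positive when
    \<open>h = 0\<close>.\<close>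
  define \<eta> where "\<eta> = e / ((L + 1) * norm h + 1)"
  have pos: "(L + 1) * norm h + 1 > 0"
    using L by (simp add: add_nonneg_pos)
  have \<eta>: "\<eta> > 0" "\<eta> * (L + 1) * norm h \<le> e"
    using e pos by (auto simp: \<eta>_def field_simps)
  obtain d where d: "d > 0"
    "\<And>y. norm (y - \<psi> q) < d \<Longrightarrow> norm (g y - g (\<psi> q) - G (y - \<psi> q)) \<le> \<eta> * norm (y - \<psi> q)"
    using g \<eta>(1) unfolding has_derivative_at_alt by metis
  obtain d' where d': "d' > 0"
    "\<And>y. norm (y - q) < d' \<Longrightarrow> norm (f y - f q - F (y - q)) \<le> \<eta> * norm (y - q)"
    using f \<eta>(1) unfolding has_derivative_at_alt by metis
  have "((\<lambda>t. q + t *\<^sub>R h) \<longlongrightarrow> q + 0 *\<^sub>R h) (at_right 0)"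
    by (intro tendsto_intros)
  then have lim: "((\<lambda>t. q + t *\<^sub>R h) \<longlongrightarrow> q) (at_right 0)"
    by simp
  have "((\<lambda>t. norm (t *\<^sub>R h)) \<longlongrightarrow> norm (0 *\<^sub>R h)) (at_right 0)"
    "((\<lambda>t. L * norm (t *\<^sub>R h)) \<longlongrightarrow> L * norm (0 *\<^sub>R h)) (at_right 0)"
    by (intro tendsto_intros)+
  then have "\<forall>\<^sub>F t in at_right 0. q + t *\<^sub>R h \<in> S \<and> norm (t *\<^sub>R h) < d' \<and>
      L * norm (t *\<^sub>R h) < d \<and> t > 0"
    using topological_tendstoD[OF lim S] d(1) d'(1) eventually_at_right_less[of "0::real"]
    by (intro eventually_conj order_tendstoD(2)) auto
  then obtain t where t: "q + t *\<^sub>R h \<in> S" "norm (t *\<^sub>R h) < d'" "L * norm (t *\<^sub>R h) < d" "t > 0"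
    using eventually_happens trivial_limit_at_right_real by (metis (no_types, lifting))
  let ?y = "\<psi> (q + t *\<^sub>R h)"
  have n: "norm (?y - \<psi> q) \<le> L * norm (t *\<^sub>R h)"
    using lipschitz_onD[OF lip t(1) S(2)] by (simp add: dist_norm)
  have "norm (g ?y - g (\<psi> q)) \<le> norm (g ?y - g (\<psi> q) - G (?y - \<psi> q)) + norm (G (?y - \<psi> q))"
    by (metis diff_add_cancel norm_triangle_ineq)
  also have "\<dots> \<le> \<eta> * norm (?y - \<psi> q) + M * norm (?y - \<psi> q)"
    using d(2)[of ?y] M(1)[of "?y - \<psi> q"] n t(3) by linarith
  also have "\<dots> = (\<eta> + M) * norm (?y - \<psi> q)"
    by (simp add: algebra_simps)
  also have "\<dots> \<le> (\<eta> + M) * (L * norm (t *\<^sub>R h))"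
    using n \<eta>(1) M(2) by (intro mult_left_mono) auto
  finally have 1: "norm (f (q + t *\<^sub>R h) - f q) \<le> (\<eta> + M) * (L * norm (t *\<^sub>R h))"
    using eq t(1) S(2) by simp
  have 2: "norm (f (q + t *\<^sub>R h) - f q - F (t *\<^sub>R h)) \<le> \<eta> * norm (t *\<^sub>R h)"
    using d'(2)[of "q + t *\<^sub>R h"] t(2) by simp
  have "t * norm (F h) = norm (F (t *\<^sub>R h))"
    using t(4) by (simp add: linear_cmul[OF has_derivative_linear[OF f]])
  also have "\<dots> \<le> norm (f (q + t *\<^sub>R h) - f q) + norm (f (q + t *\<^sub>R h) - f q - F (t *\<^sub>R h))"
    using norm_triangle_ineq4[of "f (q + t *\<^sub>R h) - f q" "f (q + t *\<^sub>R h) - f q - F (t *\<^sub>R h)"]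
    by simp
  also have "\<dots> \<le> (\<eta> + M) * (L * norm (t *\<^sub>R h)) + \<eta> * norm (t *\<^sub>R h)"
    using 1 2 by simp
  also have "\<dots> = t * (L * M * norm h + \<eta> * (L + 1) * norm h)"
    using t(4) by (simp add: algebra_simps)
  finally have "norm (F h) \<le> L * M * norm h + \<eta> * (L + 1) * norm h"
    using t(4) by simp
  then show "norm (F h) \<le> L * M * norm h + e"
    using \<eta>(2) by simp
qed

section \<open>The differential of the germ, and auxiliary norm and limit facts\<close>

definition germ_family_deriv ::
    "'n::finite \<Rightarrow> 'n \<Rightarrow> 'k::comm_ring_1 \<Rightarrow> 'k ^ 'n \<Rightarrow> 'k ^ 'n \<Rightarrow> 'k" where
  "germ_family_deriv i j l x h =
     (3 * (x $ i) ^ 2 - 3 * l ^ 2 * (x $ j) ^ 4) * h $ i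
     + (6 * (x $ j) ^ 5 - 12 * l ^ 2 * x $ i * (x $ j) ^ 3) * h $ j
     + (\<Sum>k\<in>UNIV - {i, j}. 2 * x $ k * h $ k)"

lemma has_derivative_germ_family:
  fixes x :: "'k::real_normed_field ^ 'n"
  shows "(germ_family i j l has_derivative germ_family_deriv i j l x) (at x)"
proof -
  have nth: "((\<lambda>x. x $ k) has_derivative (\<lambda>h. h $ k)) (at x)" for k and x :: "'k ^ 'n"
    by (rule bounded_linear_imp_has_derivative[OF bounded_linear_vec_nth])
  have "((\<lambda>x. (x $ i) ^ 3 - 3 * l ^ 2 * x $ i * (x $ j) ^ 4 + (x $ j) ^ 6
      + (\<Sum>k\<in>UNIV - {i, j}. (x $ k) ^ 2)) has_derivative germ_family_deriv i j l x) (at x)"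
    unfolding germ_family_deriv_def
    by (rule derivative_eq_intros nth refl)+ (simp add: algebra_simps)
  then show ?thesis
    by (simp add: germ_family_def[abs_def] Let_def)
qed

lemma norm_axis: "norm (axis k z) = norm z"
  for z :: "'a::real_normed_vector"
proof -
  have "(\<Sum>n\<in>UNIV. (norm (axis k z $ n))\<^sup>2) = (\<Sum>n\<in>UNIV. if n = k then (norm z)\<^sup>2 else 0)"
    by (intro sum.cong) (auto simp: axis_def)
  then show ?thesis
    by (simp add: norm_vec_def L2_set_def)
qed

lemma tendsto_0_at_right_of_norm_le:
  fixes f :: "real \<Rightarrow> 'b::real_normed_vector"
  assumes "\<forall>\<^sub>F e in at_right 0. norm (f e) \<le> C * e"
  shows "(f \<longlongrightarrow> 0) (at_right 0)"
proof (rule Lim_null_comparison[OF assms])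
  have "((\<lambda>e. C * e) \<longlongrightarrow> C * 0) (at_right 0)"
    by (intro tendsto_intros)
  then show "((\<lambda>e. C * e) \<longlongrightarrow> 0) (at_right 0)"
    by simp
qed

section \<open>Algebra of the limit equations\<close>

text \<open>\<open>T\<close> and \<open>T'\<close> have equal squares but, as \<open>b\<close> is
  nonzero, are distinct; so \<open>T' = - T\<close>. Adding the cubic equations gives
  \<open>S ^ 6 = 1\<close>, and the first one then reads \<open>b = a ^ 2 * T * S ^ 4\<close> with
  \<open>T = \<plusminus> a * S ^ 2\<close>. In the application \<open>a\<close> is \<open>l\<close>
  and \<open>b\<close> is \<open>l' ^ 3\<close>.\<close>

lemma cube_eq_of_limit_equations:
  fixes a b S T T' :: "'a::field_char_0"
  assumes T2: "T ^ 2 = a ^ 2 * S ^ 4" "T' ^ 2 = a ^ 2 * S ^ 4"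
    and T3: "T ^ 3 - 3 * a ^ 2 * T * S ^ 4 + S ^ 6 = 1 - 2 * b"
      "T' ^ 3 - 3 * a ^ 2 * T' * S ^ 4 + S ^ 6 = 1 + 2 * b"
    and b: "b \<noteq> 0"
  shows "a ^ 3 = b \<or> a ^ 3 = - b"
proof -
  have "T' \<noteq> T"
  proof
    assume "T' = T"
    have "4 * b = (1 + 2 * b) - (1 - 2 * b)"
      by (simp add: algebra_simps)
    also have "\<dots> = 0"
      unfolding T3[symmetric] \<open>T' = T\<close> by simp
    finally show False
      using b by simp
  qed
  moreover have "T' = T \<or> T' = - T"
    using T2 by (metis power2_eq_iff)
  ultimately have T': "T' = - T"
    by blast
  have "2 * S ^ 6 = (T ^ 3 - 3 * a ^ 2 * T * S ^ 4 + S ^ 6) + (T' ^ 3 - 3 * a ^ 2 * T' * S ^ 4 + S ^ 6)"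
    unfolding T' by simp
  also have "\<dots> = 2"
    unfolding T3 by simp
  finally have S6: "S ^ 6 = 1"
    by simp
  have "T ^ 3 = T * T ^ 2"
    by (simp add: power3_eq_cube power2_eq_square)
  also have "\<dots> = a ^ 2 * T * S ^ 4"
    by (simp add: T2(1))
  finally have T3': "T ^ 3 = a ^ 2 * T * S ^ 4" .
  have "2 * b = 1 - (T ^ 3 - 3 * a ^ 2 * T * S ^ 4 + S ^ 6)"
    unfolding T3(1) by simp
  also have "\<dots> = 2 * (a ^ 2 * T * S ^ 4)"
    unfolding T3' S6 by (simp add: algebra_simps)
  finally have b_eq: "b = a ^ 2 * T * S ^ 4"
    by simp
  have "T ^ 2 = (a * S ^ 2) ^ 2"
    by (simp add: T2(1) power_mult_distrib flip: power_mult)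
  then have "T = a * S ^ 2 \<or> T = - (a * S ^ 2)"
    by (simp add: power2_eq_iff)
  moreover have "a ^ 2 * (a * S ^ 2) * S ^ 4 = a ^ 3 * S ^ 6"
    by (simp add: numeral_eq_Suc mult_ac)
  ultimately show ?thesis
    using b_eq S6 by auto
qed

section \<open>Test arcs and their images\<close>

text \<open>One direction of the equivalence: \<open>\<phi>\<close> pulls the germ of
  \<open>l\<close> back to that of \<open>l'\<close>. The sort covers both real and complex scalars,
  and \<open>heine_borel\<close> supplies convergent subsequences.\<close>

locale bilipschitz_germ_pair =
  fixes i j :: "'n::finite" and l l' :: "'k::{real_normed_field,heine_borel}"
    and \<phi> \<psi> :: "'k ^ 'n \<Rightarrow> 'k ^ 'n" and L r :: real
  assumes ij: "i \<noteq> j" and r: "r > 0" and \<phi>0: "\<phi> 0 = 0"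
    and inv: "\<And>x. x \<in> ball 0 r \<Longrightarrow> \<psi> (\<phi> x) = x"
    and f\<phi>: "\<And>x. x \<in> ball 0 r \<Longrightarrow> germ_family i j l (\<phi> x) = germ_family i j l' x"
    and g\<psi>: "\<And>y. y \<in> ball 0 r \<Longrightarrow> germ_family i j l' (\<psi> y) = germ_family i j l y"
    and lip\<phi>: "L-lipschitz_on (ball 0 r) \<phi>" and lip\<psi>: "L-lipschitz_on (ball 0 r) \<psi>"
begin

text \<open>For \<open>m = \<plusminus> l'\<close> this arc runs in the polar curve of the germ of
  \<open>l'\<close>, where the u- and w-derivatives vanish. The exponents are the weights 2 of u and
  1 of v, for which the part of the germ in u and v is homogeneous of degree 6.\<close>

definition pt :: "'k \<Rightarrow> real \<Rightarrow> 'k ^ 'n" where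
  "pt m e = axis i (m * of_real e ^ 2) + axis j (of_real e)"

text \<open>\<open>s\<close> and \<open>t\<close> are the v- and u-coordinates of the image point,
  rescaled by their weights.\<close>

definition s :: "'k \<Rightarrow> real \<Rightarrow> 'k" where
  "s m e = \<phi> (pt m e) $ j / of_real e"

definition t :: "'k \<Rightarrow> real \<Rightarrow> 'k" where
  "t m e = \<phi> (pt m e) $ i / of_real e ^ 2"

lemma L_nonneg: "L \<ge> 0"
  using lip\<phi> lipschitz_on_nonneg by blast

lemma pt_nth:
  "pt m e $ i = m * of_real e ^ 2" "pt m e $ j = of_real e"
  "k \<noteq> i \<Longrightarrow> k \<noteq> j \<Longrightarrow> pt m e $ k = 0"
  using ij by (auto simp: pt_def axis_def)

lemma norm_pt_le: "0 \<le> e \<Longrightarrow> e \<le> 1 \<Longrightarrow> norm (pt m e) \<le> (norm m + 1) * e"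
proof -
  assume e: "0 \<le> e" "e \<le> 1"
  have "norm (pt m e) \<le> norm m * e ^ 2 + e"
    using norm_triangle_ineq[of "axis i (m * of_real e ^ 2)" "axis j (of_real e :: 'k)"] e
    by (simp add: pt_def norm_axis norm_mult norm_power)
  also have "\<dots> \<le> norm m * e + e"
    using e by (intro add_right_mono mult_left_mono) (auto simp: power2_eq_square mult_left_le)
  finally show ?thesis
    by (simp add: algebra_simps)
qed

lemma norm_pt_diff: "norm (pt m e - pt m' e) = norm (m - m') * e ^ 2"
proof -
  have "pt m e - pt m' e = axis i ((m - m') * of_real e ^ 2)"
    by (auto simp: pt_def vec_eq_iff axis_def algebra_simps)
  then show ?thesis
    by (simp add: norm_axis norm_mult norm_power)
qed

lemma norm_\<phi>_le: "x \<in> ball 0 r \<Longrightarrow> norm (\<phi> x) \<le> L * norm x"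
  using lipschitz_onD[OF lip\<phi>, of x 0] r \<phi>0 by simp

lemma eventually_pt:
  "\<forall>\<^sub>F e in at_right 0. 0 < e \<and> e < 1 \<and> pt m e \<in> ball 0 r \<and> \<phi> (pt m e) \<in> ball 0 r"
proof -
  have "((\<lambda>e. (norm m + 1) * e) \<longlongrightarrow> (norm m + 1) * 0) (at_right 0)"
    "((\<lambda>e. L * ((norm m + 1) * e)) \<longlongrightarrow> L * ((norm m + 1) * 0)) (at_right 0)"
    by (intro tendsto_intros)+
  then have "\<forall>\<^sub>F e in at_right 0. (norm m + 1) * e < r"
    "\<forall>\<^sub>F e in at_right 0. L * ((norm m + 1) * e) < r"
    using r by (auto dest!: order_tendstoD(2))
  moreover have "\<forall>\<^sub>F e in at_right 0. e \<in> {0<..<1::real}"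
    by (rule eventually_at_right_real) simp
  ultimately show ?thesis
  proof eventually_elim
    case (elim e)
    have 1: "norm (pt m e) \<le> (norm m + 1) * e"
      using norm_pt_le elim(3) by simp
    then have 2: "pt m e \<in> ball 0 r"
      using elim(1) by simp
    have "norm (\<phi> (pt m e)) \<le> L * ((norm m + 1) * e)"
      using norm_\<phi>_le[OF 2] mult_left_mono[OF 1 L_nonneg] by linarith
    then show ?case
      using elim 2 by simp
  qed
qed

text \<open>At \<open>pt m e\<close> only the v-derivative of the germ of \<open>l'\<close>
  survives, with size of order \<open>e ^ 5\<close>; the Lipschitz inverse \<open>\<psi>\<close>
  transfers this bound to the differential of the other germ at the image.\<close>

lemma norm_deriv_at_image:
  assumes m: "m ^ 2 = l' ^ 2" and e: "0 < e" "pt m e \<in> ball 0 r" "\<phi> (pt m e) \<in> ball 0 r"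
  shows "norm (germ_family_deriv i j l (\<phi> (pt m e)) h) \<le> L * (norm (6 - 12 * l' ^ 2 * m) * e ^ 5) * norm h"
proof (rule has_derivative_norm_le_of_lipschitz_factor)
  show "(germ_family i j l has_derivative germ_family_deriv i j l (\<phi> (pt m e))) (at (\<phi> (pt m e)))"
    by (rule has_derivative_germ_family)
  show "(germ_family i j l' has_derivative germ_family_deriv i j l' (pt m e)) (at (\<psi> (\<phi> (pt m e))))"
    using has_derivative_germ_family inv[OF e(2)] by metis
  show "norm (germ_family_deriv i j l' (pt m e) h) \<le> norm (6 - 12 * l' ^ 2 * m) * e ^ 5 * norm h" for h
  proof -
    have "3 * (m * of_real e ^ 2) ^ 2 - 3 * l' ^ 2 * of_real e ^ 4 = (0 :: 'k)"
      using m by (simp add: power_mult_distrib flip: power_mult)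
    moreover have "6 * of_real e ^ 5 - 12 * l' ^ 2 * (m * of_real e ^ 2) * of_real e ^ 3 =
        (6 - 12 * l' ^ 2 * m) * of_real e ^ 5"
      by (simp add: algebra_simps flip: power_add)
    ultimately have "germ_family_deriv i j l' (pt m e) h = (6 - 12 * l' ^ 2 * m) * of_real e ^ 5 * h $ j"
      by (simp add: germ_family_deriv_def pt_nth)
    then show ?thesis
      using e(1) by (simp add: norm_mult norm_power mult_left_mono Finite_Cartesian_Product.norm_nth_le)
  qed
qed (use e g\<psi> lip\<psi> in auto)

lemma Bfun_s: "Bfun (s m) (at_right 0)"
proof (rule BfunI)
  show "\<forall>\<^sub>F e in at_right 0. norm (s m e) \<le> L * (norm m + 1)"
    using eventually_pt[of m]
  proof eventually_elim
    case (elim e)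
    have "norm (\<phi> (pt m e) $ j) \<le> L * norm (pt m e)"
      using Finite_Cartesian_Product.norm_nth_le norm_\<phi>_le elim order_trans by blast
    also have "\<dots> \<le> L * ((norm m + 1) * e)"
      using elim norm_pt_le L_nonneg by (intro mult_left_mono) auto
    finally show ?case
      using elim by (simp add: s_def norm_divide field_simps)
  qed
qed

text \<open>The two source points differ only in u, by order \<open>e ^ 2\<close>, whereas
  \<open>s\<close> divides by \<open>e\<close> alone.\<close>

lemma s_diff_tendsto: "((\<lambda>e. s m e - s m' e) \<longlongrightarrow> 0) (at_right 0)"
proof (rule tendsto_0_at_right_of_norm_le)
  show "\<forall>\<^sub>F e in at_right 0. norm (s m e - s m' e) \<le> L * norm (m - m') * e"
    using eventually_pt[of m] eventually_pt[of m']
  proof eventually_elim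
    case (elim e)
    have "norm (\<phi> (pt m e) $ j - \<phi> (pt m' e) $ j) \<le> norm (\<phi> (pt m e) - \<phi> (pt m' e))"
      using Finite_Cartesian_Product.norm_nth_le[of "\<phi> (pt m e) - \<phi> (pt m' e)" j] by simp
    also have "\<dots> \<le> L * norm (pt m e - pt m' e)"
      using lipschitz_onD[OF lip\<phi>] elim by (simp add: dist_norm)
    also have "\<dots> = L * norm (m - m') * e ^ 2"
      by (simp add: norm_pt_diff)
    finally show ?case
      using elim by (simp add: s_def norm_divide field_simps power2_eq_square flip: diff_divide_distrib)
  qed
qed

text \<open>Testing the differential on the u-axis gives \<open>3 * e ^ 4\<close> times the
  expression, and this is bounded by a multiple of \<open>e ^ 5\<close>.\<close>

lemma t_tendsto:
  assumes m: "m ^ 2 = l' ^ 2"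
  shows "((\<lambda>e. t m e ^ 2 - l ^ 2 * s m e ^ 4) \<longlongrightarrow> 0) (at_right 0)"
proof (rule tendsto_0_at_right_of_norm_le)
  define M where "M = L * norm (6 - 12 * l' ^ 2 * m)"
  show "\<forall>\<^sub>F e in at_right 0. norm (t m e ^ 2 - l ^ 2 * s m e ^ 4) \<le> (M / 3) * e"
    using eventually_pt[of m]
  proof eventually_elim
    case (elim e)
    let ?q = "\<phi> (pt m e)"
    have "germ_family_deriv i j l ?q (axis i 1) = 3 * ((?q $ i) ^ 2 - l ^ 2 * (?q $ j) ^ 4)"
      using ij by (simp add: germ_family_deriv_def axis_def algebra_simps)
    also have "\<dots> = 3 * of_real e ^ 4 * (t m e ^ 2 - l ^ 2 * s m e ^ 4)"
      using elim by (simp add: s_def t_def power_divide field_simps flip: power_mult)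
    finally have "3 * e ^ 4 * norm (t m e ^ 2 - l ^ 2 * s m e ^ 4) \<le> M * e ^ 5"
      using norm_deriv_at_image[OF m, of e "axis i 1"] elim
      by (simp add: norm_mult norm_power norm_axis M_def mult.assoc)
    also have "\<dots> = 3 * e ^ 4 * (M / 3 * e)"
      by (simp add: numeral_eq_Suc)
    finally show ?case
      using elim by simp
  qed
qed

text \<open>Compare the values of the two germs along the arc and divide by \<open>e ^ 6\<close>. By
  weighted homogeneity only the w-terms at the image have to be shown negligible.\<close>

lemma st_tendsto:
  assumes m: "m ^ 2 = l' ^ 2"
  shows "((\<lambda>e. t m e ^ 3 - 3 * l ^ 2 * t m e * s m e ^ 4 + s m e ^ 6)
    \<longlongrightarrow> 1 - 2 * l' ^ 2 * m) (at_right 0)"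
proof -
  define M where "M = L * norm (6 - 12 * l' ^ 2 * m)"
  have M: "M \<ge> 0"
    using L_nonneg by (simp add: M_def)
  \<comment> \<open>The w-derivative \<open>2 * w_k\<close> is of order \<open>e ^ 5\<close>, so the
    quotient is of order \<open>e ^ 4\<close>; since \<open>e < 1\<close> this weakens to the linear
    bound that the comparison lemma takes.\<close>
  have w: "((\<lambda>e. (\<phi> (pt m e) $ k) ^ 2 / of_real e ^ 6) \<longlongrightarrow> 0) (at_right 0)"
    if k: "k \<noteq> i" "k \<noteq> j" for k
  proof (rule tendsto_0_at_right_of_norm_le)
    show "\<forall>\<^sub>F e in at_right 0. norm ((\<phi> (pt m e) $ k) ^ 2 / of_real e ^ 6) \<le> M ^ 2 * e"
      using eventually_pt[of m]
    proof eventually_elim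
      case (elim e)
      let ?q = "\<phi> (pt m e)"
      have "(\<Sum>n\<in>UNIV - {i, j}. 2 * ?q $ n * axis k 1 $ n) =
          (\<Sum>n\<in>UNIV - {i, j}. if n = k then 2 * ?q $ k else 0)"
        by (intro sum.cong) (auto simp: axis_def)
      then have "germ_family_deriv i j l ?q (axis k 1) = 2 * ?q $ k"
        using k by (simp add: germ_family_deriv_def axis_def)
      then have "2 * norm (?q $ k) \<le> M * e ^ 5"
        using norm_deriv_at_image[OF m, of e "axis k 1"] elim
        by (simp add: norm_mult norm_axis M_def mult.assoc)
      then have "norm (?q $ k) \<le> M * e ^ 5"
        using norm_ge_zero[of "?q $ k"] by linarith
      then have "norm (?q $ k) ^ 2 \<le> (M * e ^ 5) ^ 2"
        by (intro power_mono) auto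
      also have "\<dots> = M ^ 2 * e ^ 4 * e ^ 6"
        by (simp add: power_mult_distrib flip: power_mult power_add)
      also have "\<dots> \<le> M ^ 2 * e * e ^ 6"
        using elim power_decreasing[of 1 4 e] by (intro mult_right_mono mult_left_mono) auto
      finally show ?case
        using elim by (simp add: norm_divide norm_power field_simps)
    qed
  qed
  have "((\<lambda>e. (1 - 2 * l' ^ 2 * m) - (\<Sum>k\<in>UNIV - {i, j}. (\<phi> (pt m e) $ k) ^ 2 / of_real e ^ 6))
      \<longlongrightarrow> (1 - 2 * l' ^ 2 * m) - (\<Sum>k\<in>UNIV - {i, j}. 0)) (at_right 0)"
    using w by (intro tendsto_intros) auto
  then have lim: "((\<lambda>e. (1 - 2 * l' ^ 2 * m) - (\<Sum>k\<in>UNIV - {i, j}. (\<phi> (pt m e) $ k) ^ 2 / of_real e ^ 6))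
      \<longlongrightarrow> 1 - 2 * l' ^ 2 * m) (at_right 0)"
    by simp
  have ev: "\<forall>\<^sub>F e in at_right 0.
      (1 - 2 * l' ^ 2 * m) - (\<Sum>k\<in>UNIV - {i, j}. (\<phi> (pt m e) $ k) ^ 2 / of_real e ^ 6)
      = t m e ^ 3 - 3 * l ^ 2 * t m e * s m e ^ 4 + s m e ^ 6"
    using eventually_pt[of m]
  proof eventually_elim
    case (elim e)
    let ?q = "\<phi> (pt m e)" and ?e = "of_real e :: 'k"
    have e: "?e \<noteq> 0"
      using elim by simp
    \<comment> \<open>This turns the value \<open>m ^ 3 - 3 * l' ^ 2 * m + 1\<close> on the arc into
      \<open>1 - 2 * l' ^ 2 * m\<close>.\<close>
    have m3: "m ^ 3 = l' ^ 2 * m"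
      using m by (simp add: power3_eq_cube power2_eq_square)
    have q: "?q $ i = t m e * ?e ^ 2" "?q $ j = s m e * ?e"
      using e by (auto simp: s_def t_def)
    have "germ_family i j l' (pt m e) = ?e ^ 6 * (m ^ 3 - 3 * l' ^ 2 * m + 1)"
      by (simp add: germ_family_def Let_def pt_nth power_mult_distrib algebra_simps flip: power_mult power_add)
    also have "\<dots> = ?e ^ 6 * (1 - 2 * l' ^ 2 * m)"
      by (simp add: m3 algebra_simps)
    finally have g: "germ_family i j l' (pt m e) = ?e ^ 6 * (1 - 2 * l' ^ 2 * m)" .
    have "germ_family i j l ?q = ?e ^ 6 * (t m e ^ 3 - 3 * l ^ 2 * t m e * s m e ^ 4 + s m e ^ 6)
        + (\<Sum>k\<in>UNIV - {i, j}. (?q $ k) ^ 2)"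
      unfolding germ_family_def Let_def q
      by (simp add: power_mult_distrib algebra_simps flip: power_mult power_add)
    with g f\<phi>[of "pt m e"] elim
    have "?e ^ 6 * (1 - 2 * l' ^ 2 * m) =
        ?e ^ 6 * (t m e ^ 3 - 3 * l ^ 2 * t m e * s m e ^ 4 + s m e ^ 6)
        + (\<Sum>k\<in>UNIV - {i, j}. (?q $ k) ^ 2)"
      by simp
    then show ?case
      using e by (simp add: field_simps flip: sum_divide_distrib)
  qed
  show ?thesis
    using lim tendsto_cong[OF ev] by blast
qed

text \<open>The Lipschitz estimate alone only gives \<open>t\<close> of order \<open>1 / e\<close>.
  Boundedness comes from \<open>t ^ 2 = l ^ 2 * s ^ 4 + o(1)\<close> and the boundedness of
  \<open>s\<close>.\<close>

lemma Bfun_t: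
  assumes m: "m ^ 2 = l' ^ 2"
  shows "Bfun (t m) (at_right 0)"
proof -
  obtain B where B: "\<forall>\<^sub>F e in at_right 0. norm (s m e) \<le> B"
    using Bfun_s unfolding Bfun_def by blast
  have "\<forall>\<^sub>F e in at_right 0. norm (t m e ^ 2 - l ^ 2 * s m e ^ 4) < 1"
    using order_tendstoD(2)[OF tendsto_norm[OF t_tendsto[OF m]], of 1] by simp
  then have "\<forall>\<^sub>F e in at_right 0. norm (t m e) \<le> 1 + norm l ^ 2 * B ^ 4 + 1"
    using B
  proof eventually_elim
    case (elim e)
    have "norm (t m e) ^ 2 \<le> norm (t m e ^ 2 - l ^ 2 * s m e ^ 4) + norm (l ^ 2 * s m e ^ 4)"
      by (metis diff_add_cancel norm_power norm_triangle_ineq)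
    also have "\<dots> \<le> 1 + norm l ^ 2 * B ^ 4"
      using elim by (intro add_mono) (auto simp: norm_mult norm_power intro!: mult_left_mono power_mono)
    finally have 1: "norm (t m e) ^ 2 \<le> 1 + norm l ^ 2 * B ^ 4" .
    \<comment> \<open>Expanding \<open>(norm (t m e) - 1) ^ 2 \<ge> 0\<close> passes from the
      squared bound to a linear one.\<close>
    have "2 * norm (t m e) \<le> norm (t m e) ^ 2 + 1"
      using zero_le_power2[of "norm (t m e) - 1"] by (simp add: power2_diff)
    then show ?case
      using 1 norm_ge_zero[of "t m e"] by linarith
  qed
  then show ?thesis
    by (rule BfunI)
qed

section \<open>Passage to the limit and conclusion\<close>

lemma cube_eq:
  assumes "l' \<noteq> 0"
  shows "l ^ 3 = l' ^ 3 \<or> l ^ 3 = - (l' ^ 3)"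
proof -
  have sq: "l' ^ 2 = l' ^ 2" "(- l') ^ 2 = l' ^ 2"
    by simp_all
  \<comment> \<open>Bundling the quantities yields one subsequence for both arcs.
    \<open>s (- l')\<close> is left out because its difference from \<open>s l'\<close> tends to
    0.\<close>
  define c where "c e = (s l' e, t l' e, t (- l') e)" for e
  obtain A B C where "\<forall>\<^sub>F e in at_right 0. norm (s l' e) \<le> A"
    "\<forall>\<^sub>F e in at_right 0. norm (t l' e) \<le> B" "\<forall>\<^sub>F e in at_right 0. norm (t (- l') e) \<le> C"
    using Bfun_s Bfun_t[OF sq(1)] Bfun_t[OF sq(2)] unfolding Bfun_def by metis
  then have "\<forall>\<^sub>F e in at_right 0. norm (c e) \<le> A + (B + C)"
  proof eventually_elim
    case (elim e)
    then show ?case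
      unfolding c_def
      using norm_Pair_le[of "s l' e" "(t l' e, t (- l') e)"] norm_Pair_le[of "t l' e" "t (- l') e"]
      by linarith
  qed
  then obtain b where b: "b > 0" "\<And>e. 0 < e \<Longrightarrow> e < b \<Longrightarrow> norm (c e) \<le> A + (B + C)"
    unfolding eventually_at_right_field by auto
  \<comment> \<open>The factor \<open>b / 2\<close> keeps every term, including the one at
    \<open>n = 0\<close>, strictly below \<open>b\<close>.\<close>
  define \<epsilon> where "\<epsilon> n = b / 2 * inverse (real (Suc n))" for n
  have \<epsilon>: "0 < \<epsilon> n" "\<epsilon> n < b" for n
    using b(1) by (auto simp: \<epsilon>_def field_simps add_pos_nonneg)
  have "\<epsilon> \<longlonglongrightarrow> 0"
    unfolding \<epsilon>_def using tendsto_mult_left[OF LIMSEQ_inverse_real_of_nat, of "b / 2"] by simp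
  then have \<epsilon>lim: "filterlim \<epsilon> (at_right 0) sequentially"
    using \<epsilon>(1) by (intro tendsto_imp_filterlim_at_right) simp_all
  have "bounded (range (\<lambda>n. c (\<epsilon> n)))"
    using b(2) \<epsilon> by (auto simp: bounded_iff)
  then obtain lims k where k: "strict_mono k" "((\<lambda>n. c (\<epsilon> n)) \<circ> k) \<longlonglongrightarrow> lims"
    using bounded_imp_convergent_subsequence by blast
  obtain S T T' where lims: "lims = (S, T, T')"
    by (cases lims)
  define \<delta> where "\<delta> n = \<epsilon> (k n)" for n
  have \<delta>: "filterlim \<delta> (at_right 0) sequentially"
    unfolding \<delta>_def using \<epsilon>lim filterlim_subseq[OF k(1)] filterlim_compose by blast
  have "(\<lambda>n. c (\<delta> n)) \<longlonglongrightarrow> (S, T, T')"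
    using k(2) lims by (simp add: \<delta>_def o_def)
  from tendsto_fst[OF this] tendsto_fst[OF tendsto_snd[OF this]] tendsto_snd[OF tendsto_snd[OF this]]
  have S: "(\<lambda>n. s l' (\<delta> n)) \<longlonglongrightarrow> S" and T: "(\<lambda>n. t l' (\<delta> n)) \<longlonglongrightarrow> T"
    and T': "(\<lambda>n. t (- l') (\<delta> n)) \<longlonglongrightarrow> T'"
    by (simp_all add: c_def)
  have S': "(\<lambda>n. s (- l') (\<delta> n)) \<longlonglongrightarrow> S"
    using tendsto_diff[OF S filterlim_compose[OF s_diff_tendsto[of l' "- l'"] \<delta>]] by simp
  have eq: "T0 ^ 2 = l ^ 2 * S ^ 4 \<and> T0 ^ 3 - 3 * l ^ 2 * T0 * S ^ 4 + S ^ 6 = 1 - 2 * l' ^ 2 * m"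
    if "m ^ 2 = l' ^ 2" "(\<lambda>n. s m (\<delta> n)) \<longlonglongrightarrow> S" "(\<lambda>n. t m (\<delta> n)) \<longlonglongrightarrow> T0" for m T0
  proof
    have "(\<lambda>n. t m (\<delta> n) ^ 2 - l ^ 2 * s m (\<delta> n) ^ 4) \<longlonglongrightarrow> T0 ^ 2 - l ^ 2 * S ^ 4"
      by (intro tendsto_intros that)
    from LIMSEQ_unique[OF this filterlim_compose[OF t_tendsto[OF that(1)] \<delta>]]
    show "T0 ^ 2 = l ^ 2 * S ^ 4"
      by simp
    have "(\<lambda>n. t m (\<delta> n) ^ 3 - 3 * l ^ 2 * t m (\<delta> n) * s m (\<delta> n) ^ 4 + s m (\<delta> n) ^ 6)
        \<longlonglongrightarrow> T0 ^ 3 - 3 * l ^ 2 * T0 * S ^ 4 + S ^ 6"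
      by (intro tendsto_intros that)
    from LIMSEQ_unique[OF this filterlim_compose[OF st_tendsto[OF that(1)] \<delta>]]
    show "T0 ^ 3 - 3 * l ^ 2 * T0 * S ^ 4 + S ^ 6 = 1 - 2 * l' ^ 2 * m" .
  qed
  have l3: "l' ^ 2 * l' = l' ^ 3"
    by (simp add: power3_eq_cube power2_eq_square)
  have T2: "T ^ 2 = l ^ 2 * S ^ 4" "T' ^ 2 = l ^ 2 * S ^ 4"
    and T3: "T ^ 3 - 3 * l ^ 2 * T * S ^ 4 + S ^ 6 = 1 - 2 * l' ^ 3"
      "T' ^ 3 - 3 * l ^ 2 * T' * S ^ 4 + S ^ 6 = 1 + 2 * l' ^ 3"
    using eq[OF sq(1) S T] eq[OF sq(2) S' T'] by (simp_all add: mult.assoc l3)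
  show ?thesis
    using cube_eq_of_limit_equations[OF T2 T3] assms by simp
qed

end

text \<open>If \<open>l' = 0\<close> the two arcs coincide and carry no information, so the roles of
  the germs are exchanged through \<open>\<psi>\<close>; if both parameters vanish the claim is
  trivial.\<close>

lemma cube_eq_of_bilipschitz_equivalent:
  fixes l l' :: "'k::{real_normed_field,heine_borel}" and i j :: "'n::finite"
  assumes "i \<noteq> j" and "bilipschitz_equivalent (germ_family i j l) (germ_family i j l')"
  shows "l ^ 3 = l' ^ 3 \<or> l ^ 3 = - (l' ^ 3)"
proof -
  from assms(2) obtain \<phi> \<psi> L r where *: "L > 0" "r > 0" "\<phi> 0 = 0" "\<psi> 0 = 0"
    "\<And>x. x \<in> ball 0 r \<Longrightarrow> \<psi> (\<phi> x) = x" "\<And>y. y \<in> ball 0 r \<Longrightarrow> \<phi> (\<psi> y) = y"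
    "\<And>x. x \<in> ball 0 r \<Longrightarrow> germ_family i j l (\<phi> x) = germ_family i j l' x"
    "\<And>y. y \<in> ball 0 r \<Longrightarrow> germ_family i j l' (\<psi> y) = germ_family i j l y"
    "L-lipschitz_on (ball 0 r) \<phi>" "L-lipschitz_on (ball 0 r) \<psi>"
    by (elim bilipschitz_equivalentE) blast
  interpret fwd: bilipschitz_germ_pair i j l l' \<phi> \<psi> L r
    by unfold_locales (use assms(1) * in auto)
  interpret bwd: bilipschitz_germ_pair i j l' l \<psi> \<phi> L r
    by unfold_locales (use assms(1) * in auto)
  consider "l' \<noteq> 0" | "l \<noteq> 0" | "l = 0" "l' = 0"
    by blast
  then show ?thesis
  proof cases
    case 2
    then show ?thesis
      using bwd.cube_eq by (metis minus_minus)
  qed (use fwd.cube_eq in auto)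
qed

theorem theorem6p4:
  fixes i j :: "'n::finite"
  assumes "i \<noteq> j"
  shows
    "(\<forall>l l' :: complex.
        1 + 2 * l ^ 3 \<noteq> 0 \<and> 1 - 2 * l ^ 3 \<noteq> 0 \<and> 1 + 2 * l' ^ 3 \<noteq> 0 \<and> 1 - 2 * l' ^ 3 \<noteq> 0 \<longrightarrow>
        bilipschitz_equivalent (germ_family i j l) (germ_family i j l') \<longrightarrow>
        l ^ 3 = l' ^ 3 \<or> l ^ 3 = - (l' ^ 3)) \<and>
     (\<forall>l l' :: real.
        1 + 2 * l ^ 3 \<noteq> 0 \<and> 1 - 2 * l ^ 3 \<noteq> 0 \<and> 1 + 2 * l' ^ 3 \<noteq> 0 \<and> 1 - 2 * l' ^ 3 \<noteq> 0 \<longrightarrow>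
        bilipschitz_equivalent (germ_family i j l) (germ_family i j l') \<longrightarrow>
        l ^ 3 = l' ^ 3 \<or> l ^ 3 = - (l' ^ 3))"
  by (intro conjI allI impI cube_eq_of_bilipschitz_equivalent[OF assms])

end
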